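(* Let $\widehat{G}=(\widehat{V},\widehat{E},\widehat{w})$ be a weighted graph with a fixed weight function $\widehat{w}$, and suppose that $\widehat{G}$ is $\mathrm{SRSI}_{\widehat{w}}(u)$ for some vertex $u\in\widehat{V}$. Let $G=(V,E,w)$ be any weighted graph obtained from $\widehat{G}$ by graph expansion at $u$ by a new vertex $v$. Then $G$ is $\mathrm{SRSI}_w(v)$.
   Context: All graphs are simple. A weight function on a graph $G=(V,E)$ is a function $w:E\to\mathbb{R}^+$ to the positive reals. A $k$-matching is a set of $k$ pairwise disjoint edges. For a weighted graph on $n$ vertices, the weighted matching polynomial is $$m_w(G,x)=\sum_{k=0}^{\lfloor n/2\rfloor}(-1)^k\mu_w(G,k)\,x^{n-2k},\qquad \mu_w(G,k)=\sum_{M\text{ a }k\text{-matching of }G}\ \prod_{e\in M}w(e),$$ with $\mu_w(G,0)=1$. On subgraphs, $w$ is understood to be restricted. $G\setminus\{v\}$ denotes the graph obtained by deleting the vertex $v$. All roots of $m_w(G,x)$ are real. A weighted graph $G=(V,E,w)$ on $n\ge 2$ vertices is $\mathrm{SRSI}_w(v)$, where $v\in V$, if: (1) $m_w(G,x)$ has simple roots $\lambda_1<\dots<\lambda_n$; and (2) $m_w(G\setminus\{v\},x)$ has simple roots $\mu_1<\dots<\mu_{n-1}$ that strictly interlace those of $m_w(G,x)$, i.e. $\lambda_1<\mu_1<\lambda_2<\dots<\mu_{n-1}<\lambda_n$. Graph expansion: given a weighted graph $\widehat{G}=(\widehat{V},\widehat{E},\widehat{w})$, a vertex $u\in\widehat{V}$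 and a new vertex $v\notin\widehat{V}$, a graph expansion of $\widehat{G}$ at $u$ by $v$ is a weighted graph $G=(V,E,w)$ with $V=\widehat{V}\cup\{v\}$ and $E=\widehat{E}\cup\{\hat e_1,\dots,\hat e_s\}$, $s\ge 1$, where $\hat e_1=\{u,v\}$ and, for $i\ge 2$, $\hat e_i=\{v,v_i\}$ for some $v_i\in\widehat{V}$ with $v_i\ne u$; the weight function $w$ agrees with $\widehat{w}$ on $\widehat{E}$, and the new edges $\hat e_1,\dots,\hat e_s$ may have arbitrary (positive) weights. *)

theory Defs
  imports Complex_Main "HOL-Computational_Algebra.Polynomial"
begin

text \<open>
  Graphs are finite and simple, given by a vertex set \<open>V\<close> and a set \<open>E\<close> of two-element subsets
  of \<open>V\<close>. A weight function is a total function on sets of vertices; only its values on \<open>E\<close>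
  matter, so restricting it to a subgraph needs no notation.
\<close>

definition weighted_graph :: "'a set \<Rightarrow> 'a set set \<Rightarrow> ('a set \<Rightarrow> real) \<Rightarrow> bool" where
  "weighted_graph V E w \<longleftrightarrow>
     finite V \<and> (\<forall>e\<in>E. e \<subseteq> V \<and> card e = 2) \<and> (\<forall>e\<in>E. w e > 0)"

definition matchings :: "'a set set \<Rightarrow> nat \<Rightarrow> 'a set set set" where
  "matchings E k = {M. M \<subseteq> E \<and> card M = k \<and> pairwise disjnt M}"

definition matching_weight :: "'a set set \<Rightarrow> ('a set \<Rightarrow> real) \<Rightarrow> nat \<Rightarrow> real" where
  "matching_weight E w k = (\<Sum>M\<in>matchings E k. \<Prod>e\<in>M. w e)"

definition matching_poly :: "'a set \<Rightarrow> 'a set set \<Rightarrow> ('a set \<Rightarrow> real) \<Rightarrow> real poly" where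
  "matching_poly V E w =
     (\<Sum>k = 0..card V div 2. monom ((-1) ^ k * matching_weight E w k) (card V - 2 * k))"

definition edges_without :: "'a set set \<Rightarrow> 'a \<Rightarrow> 'a set set" where
  "edges_without E v = {e \<in> E. v \<notin> e}"

text \<open>
  The roots of \<open>p\<close> are exactly \<open>r 1 < \<dots> < r n\<close>, and each is simple. For a polynomial \<open>p\<close> of
  degree \<open>n\<close>, as in every use below, these are also all of its complex roots.
\<close>

definition has_simple_roots :: "real poly \<Rightarrow> nat \<Rightarrow> (nat \<Rightarrow> real) \<Rightarrow> bool" where
  "has_simple_roots p n r \<longleftrightarrow>
     strict_mono_on {1..n} r \<and> {x. poly p x = 0} = r ` {1..n} \<and> (\<forall>i\<in>{1..n}. order (r i) p = 1)"

definition SRSI :: "'a set \<Rightarrow> 'a set set \<Rightarrow> ('a set \<Rightarrow> real) \<Rightarrow> 'a \<Rightarrow> bool" where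
  "SRSI V E w v \<longleftrightarrow>
     weighted_graph V E w \<and> card V \<ge> 2 \<and> v \<in> V \<and>
     (\<exists>lam mu.
        has_simple_roots (matching_poly V E w) (card V) lam \<and>
        has_simple_roots (matching_poly (V - {v}) (edges_without E v) w) (card V - 1) mu \<and>
        (\<forall>i\<in>{1..card V - 1}. lam i < mu i \<and> mu i < lam (i + 1)))"

text \<open>
  In \<open>graph_expansion V' E' w' u v V E w\<close> the graph \<open>(V, E, w)\<close> expands \<open>(V', E', w')\<close> at \<open>u\<close>
  by \<open>v\<close>. The set \<open>N\<close> consists of \<open>u\<close> and the other neighbours \<open>v\<^sub>2, \<dots>, v\<^sub>s\<close> of \<open>v\<close>.
\<close>

definition graph_expansion ::
  "'a set \<Rightarrow> 'a set set \<Rightarrow> ('a set \<Rightarrow> real) \<Rightarrow> 'a \<Rightarrow> 'a \<Rightarrow>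
   'a set \<Rightarrow> 'a set set \<Rightarrow> ('a set \<Rightarrow> real) \<Rightarrow> bool" where
  "graph_expansion V' E' w' u v V E w \<longleftrightarrow>
     weighted_graph V' E' w' \<and> weighted_graph V E w \<and>
     u \<in> V' \<and> v \<notin> V' \<and> V = V' \<union> {v} \<and>
     (\<exists>N. u \<in> N \<and> N \<subseteq> V' \<and> E = E' \<union> (\<lambda>x. {v, x}) ` N) \<and>
     (\<forall>e\<in>E'. w e = w' e)"

end

theory Submission imports Defs begin

text \<open>
  Write \<open>P\<close> and \<open>Q\<close> for the matching polynomials of \<open>G\<close> and \<open>G'\<close>, and \<open>R\<^sub>k\<close> for that of \<open>G' - k\<close>.
  Splitting matchings according to the edge covering \<open>v\<close> gives \<open>P = x Q - (\<Sum>k\<in>N. w{v,k} R\<^sub>k)\<close>.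
  The same recursion shows by induction that the Wronskian \<open>R\<^sub>k Q' - R\<^sub>k' Q\<close> is nonnegative on the
  real line, so \<open>R\<^sub>k Q' \<ge> 0\<close> at each root of \<open>Q\<close>, with strict inequality for \<open>k = u\<close> because the
  roots of \<open>Q\<close> are simple and none is a root of \<open>R\<^sub>u\<close>. Hence \<open>P Q' < 0\<close> at the roots of \<open>Q\<close>; as the sign
  of \<open>Q'\<close> alternates there, so does that of \<open>P\<close>, and the intermediate value theorem together with
  the behaviour of \<open>P\<close> at infinity yields \<open>n + 1\<close> roots of \<open>P\<close> strictly interlacing those of \<open>Q\<close>.
\<close>

section \<open>Real polynomials with simple roots\<close>

text \<open>Two polynomials of degree at most \<open>n\<close> with the same coefficient at
  \<open>n\<close> coincide once they agree at \<open>n\<close> distinct points; here both are monic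
  and vanish on \<open>r\<close>.\<close>

lemma has_simple_roots_imp_prod:
  assumes "has_simple_roots p n r" "degree p = n" "lead_coeff p = 1"
  shows "p = (\<Prod>j\<in>{1..n}. [:- r j, 1:])"
proof (rule poly_eqI_degree_lead_coeff[where n = n and A = "r ` {1..n}"])
  have deg: "degree (\<Prod>j\<in>{1..n}. [:- r j, 1:]) = n"
    by (subst degree_prod_eq_sum_degree) auto
  have "lead_coeff (\<Prod>j\<in>{1..n}. [:- r j, 1:]) = 1"
    by (simp add: lead_coeff_prod)
  then show "coeff p n = coeff (\<Prod>j\<in>{1..n}. [:- r j, 1:]) n"
    using deg assms(2,3) by metis
  have "inj_on r {1..n}"
    using assms(1) by (auto simp: has_simple_roots_def intro: strict_mono_on_imp_inj_on)
  then show "card (r ` {1..n}) \<ge> n"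
    by (simp add: card_image)
  show "degree p \<le> n" "degree (\<Prod>j\<in>{1..n}. [:- r j, 1:]) \<le> n"
    using deg assms(2) by simp_all
  fix z assume z: "z \<in> r ` {1..n}"
  then have "poly p z = 0"
    using assms(1) unfolding has_simple_roots_def by blast
  then show "poly p z = poly (\<Prod>j\<in>{1..n}. [:- r j, 1:]) z"
    using z by (auto simp: poly_prod intro!: prod_zero[symmetric])
qed

text \<open>Exactly the \<open>n - i\<close> factors with \<open>j > i\<close> are negative.\<close>

lemma strict_mono_on_sign_prod_diff:
  fixes r :: "nat \<Rightarrow> real"
  assumes "strict_mono_on {1..n} r" "i \<in> {1..n}"
  shows "(-1) ^ (n - i) * (\<Prod>j\<in>{1..n} - {i}. r i - r j) > 0"
proof -
  have split: "{1..n} - {i} = {1..<i} \<union> {i<..n}"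
    using assms(2) by auto
  have "(\<Prod>j\<in>{i<..n}. r i - r j) = (\<Prod>j\<in>{i<..n}. (-1) * (r j - r i))"
    by simp
  also have "\<dots> = (-1) ^ (n - i) * (\<Prod>j\<in>{i<..n}. r j - r i)"
    by (subst prod.distrib) simp
  finally have neg: "(-1) ^ (n - i) * (\<Prod>j\<in>{i<..n}. r i - r j) = (\<Prod>j\<in>{i<..n}. r j - r i)"
    by (simp add: mult.assoc[symmetric] power_mult_distrib[symmetric])
  have "(\<Prod>j\<in>{i<..n}. r j - r i) > 0" "(\<Prod>j\<in>{1..<i}. r i - r j) > 0"
    using assms by (auto intro!: prod_pos simp: strict_mono_on_def)
  moreover have "(\<Prod>j\<in>{1..n} - {i}. r i - r j) =
      (\<Prod>j\<in>{1..<i}. r i - r j) * (\<Prod>j\<in>{i<..n}. r i - r j)"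
    unfolding split by (rule prod.union_disjoint) auto
  ultimately show ?thesis
    using neg by (metis mult.left_commute mult_pos_pos)
qed

lemma has_simple_roots_pderiv_sign:
  assumes "has_simple_roots p n r" "degree p = n" "lead_coeff p = 1" "i \<in> {1..n}"
  shows "(-1) ^ (n - i) * poly (pderiv p) (r i) > 0"
proof -
  have "poly (pderiv p) (r i) = (\<Sum>a\<in>{1..n}. \<Prod>j\<in>{1..n} - {a}. r i - r j)"
    unfolding has_simple_roots_imp_prod[OF assms(1-3)] pderiv_prod
    by (simp add: poly_sum poly_prod pderiv_pCons)
  \<comment> \<open>Every summand with \<open>a \<noteq> i\<close> retains the zero factor
    \<open>r i - r i\<close>.\<close>
  also have "\<dots> = (\<Sum>a\<in>{i}. \<Prod>j\<in>{1..n} - {a}. r i - r j)"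
    by (rule sum.mono_neutral_right) (use assms(4) in \<open>auto intro!: bexI[of _ i]\<close>)
  finally show ?thesis
    using strict_mono_on_sign_prod_diff[of n r i] assms(1,4) by (simp add: has_simple_roots_def)
qed

text \<open>Counting against the degree: \<open>n\<close> distinct roots leave no room for a further
  root, and the orders sum to at most \<open>n\<close>, so none exceeds 1.\<close>

lemma has_simple_rootsI:
  assumes "strict_mono_on {1..n} r" "\<And>i. i \<in> {1..n} \<Longrightarrow> poly p (r i) = 0"
    and "p \<noteq> 0" "degree p = n"
  shows "has_simple_roots p n r"
proof -
  have fin: "finite {x. poly p x = 0}"
    using assms(3) by (simp add: poly_roots_finite)
  have card: "card (r ` {1..n}) = n"
    using strict_mono_on_imp_inj_on[OF assms(1)] by (simp add: card_image)
  have sub: "r ` {1..n} \<subseteq> {x. poly p x = 0}"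
    using assms(2) by auto
  have eq: "r ` {1..n} = {x. poly p x = 0}"
    using card_subset_eq[OF fin sub] card_mono[OF fin sub] card card_poly_roots_bound[OF assms(3)]
      assms(4) by simp
  have pos: "order x p \<ge> 1" if "poly p x = 0" for x
    using that assms(3) order_root[of p x] by simp
  have "order (r i) p = 1" if i: "i \<in> {1..n}" for i
  proof (rule ccontr)
    assume "order (r i) p \<noteq> 1"
    then have "1 < order (r i) p"
      using pos[OF assms(2)[OF i]] by simp
    then have "(\<Sum>x | poly p x = 0. 1) < (\<Sum>x | poly p x = 0. order x p)"
      using fin pos assms(2)[OF i] by (intro sum_strict_mono_ex1) auto
    then show False
      using sum_order_le_degree[OF assms(3)] assms(4) card eq by simp
  qed
  then show ?thesis
    using assms(1) eq unfolding has_simple_roots_def by simp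
qed

lemma ex_interlacing_roots:
  fixes p q :: "real poly"
  assumes p: "degree p = n + 1" "lead_coeff p = 1"
    and q: "degree q = n" "lead_coeff q = 1" "has_simple_roots q n r"
    and n: "n \<ge> 1"
    and sign: "\<And>i. i \<in> {1..n} \<Longrightarrow> poly p (r i) * poly (pderiv q) (r i) < 0"
  shows "\<exists>lam. has_simple_roots p (n + 1) lam \<and> (\<forall>i\<in>{1..n}. lam i < r i \<and> r i < lam (i + 1))"
proof -
  obtain b where b: "b > r n" "poly p b > 0"
  proof -
    obtain c where "\<And>x. x \<ge> c \<Longrightarrow> poly p x \<ge> lead_coeff p"
      using poly_pinfty_gt_lc[of p] p(2) by auto
    then show thesis
      using that[of "max c (r n + 1)"] p(2) by (metis less_le_trans less_add_one max.cobounded1 max.cobounded2 zero_less_one)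
  qed
  obtain a where a: "a < r 1" "(-1) ^ (n + 1) * poly p a > 0"
  proof -
    \<comment> \<open>Reflecting \<open>p\<close> at the origin and correcting the sign gives a
      monic polynomial, so the behaviour at minus infinity follows from that at plus
      infinity.\<close>
    define p' where "p' = smult ((-1) ^ (n + 1)) (pcompose p [:0, -1:])"
    have "lead_coeff p' = 1"
      using p unfolding p'_def
      by (simp add: lead_coeff_comp power_mult_distrib[symmetric] del: power_Suc)
    then obtain c where c: "\<And>x. x \<ge> c \<Longrightarrow> poly p' x \<ge> 1"
      using poly_pinfty_gt_lc[of p'] by auto
    have "poly p' (max c (1 - r 1)) \<ge> 1"
      by (rule c) simp
    then have "(-1) ^ (n + 1) * poly p (- max c (1 - r 1)) > 0"
      unfolding p'_def by (simp add: poly_pcompose)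
    then show thesis
      by (intro that[of "- max c (1 - r 1)"]) auto
  qed
  \<comment> \<open>Appending \<open>a\<close> and \<open>b\<close> at indices 0 and
    \<open>n + 1\<close> turns the two unbounded gaps into ordinary intervals, \<open>n + 1\<close>
    in all.\<close>
  define s where "s i = (if i = 0 then a else if i = n + 1 then b else r i)" for i
  have mono_r: "strict_mono_on {1..n} r"
    using q(3) by (simp add: has_simple_roots_def)
  have s_less: "s i < s (i + 1)" if "i \<le> n" for i
    using that a(1) b(1) n mono_r by (auto simp: s_def strict_mono_on_def)
  have s_sign: "(-1) ^ (n + i) * poly p (s i) < 0" if i: "i \<le> n + 1" for i
  proof -
    consider "i = 0" | "i = n + 1" | "i \<in> {1..n}"
      using i by fastforce
    then show ?thesis
    proof cases
      case 3
      \<comment> \<open>The exponents differ by \<open>2 * i\<close>, so the sign of the derivative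
        can be stated without subtraction.\<close>
      have eq: "(-1) ^ (n + i) = ((-1) ^ (n - i) :: real)"
        using 3 by (simp add: minus_one_power_iff)
      have "(-1) ^ (n + i) * poly (pderiv q) (r i) > 0"
        using has_simple_roots_pderiv_sign[OF q(3,1,2) 3] eq by simp
      then show ?thesis
        using sign[OF 3] 3 by (auto simp: s_def minus_one_power_iff mult_less_0_iff split: if_splits)
    qed (use a b in \<open>auto simp: s_def\<close>)
  qed
  have "\<exists>x. s i < x \<and> x < s (i + 1) \<and> poly p x = 0" if "i \<le> n" for i
  proof -
    have "poly p (s i) * poly p (s (i + 1)) < 0"
      using s_sign[of i] s_sign[of "i + 1"] that
      by (auto simp: minus_one_power_iff mult_less_0_iff split: if_splits)
    then show ?thesis
      using poly_IVT[OF s_less[OF that]] by blast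
  qed
  then obtain l where l: "\<And>i. i \<le> n \<Longrightarrow> s i < l i \<and> l i < s (i + 1) \<and> poly p (l i) = 0"
    by metis
  \<comment> \<open>Gaps are numbered from 0 but roots from 1.\<close>
  define lam where "lam i = l (i - 1)" for i
  have inter: "lam i < r i \<and> r i < lam (i + 1)" if "i \<in> {1..n}" for i
    using l[of "i - 1"] l[of i] that by (cases i) (auto simp: lam_def s_def)
  have "strict_mono_on {1..n + 1} lam"
  proof (rule strict_mono_onI)
    fix i j assume ij: "i \<in> {1..n + 1}" "j \<in> {1..n + 1}" "i < j"
    have "lam i < r i"
      using inter ij by auto
    also have "r i \<le> r (j - 1)"
      using ij by (intro strict_mono_on_leD[OF mono_r]) auto
    also have "\<dots> < lam j"
      using inter[of "j - 1"] ij by (cases j) auto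
    finally show "lam i < lam j" .
  qed
  then have "has_simple_roots p (n + 1) lam"
    by (rule has_simple_rootsI) (use l p in \<open>auto simp: lam_def\<close>)
  then show ?thesis
    using inter by blast
qed

section \<open>The matching polynomial\<close>

text \<open>Forgetting the size lets the polynomial be written as one sum over matchings, whose
  index set can then be split and reindexed without tracking \<open>k\<close>.\<close>

definition all_matchings :: "'a set set \<Rightarrow> 'a set set set" where
  "all_matchings E = {M. M \<subseteq> E \<and> pairwise disjnt M}"

lemma weighted_graph_finite_edges: "weighted_graph V E w \<Longrightarrow> finite E"
  unfolding weighted_graph_def by (meson PowI finite_Pow_iff finite_subset subsetI)

lemma finite_all_matchings: "finite E \<Longrightarrow> finite (all_matchings E)"
  unfolding all_matchings_def by simp

lemma weighted_graph_edges_without: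
  "weighted_graph V E w \<Longrightarrow> weighted_graph (V - {v}) (edges_without E v) w"
  unfolding weighted_graph_def edges_without_def by auto

text \<open>The disjoint edges of \<open>M\<close> cover \<open>2 * card M\<close> vertices. Thus
  the natural-number subtraction in the exponents never truncates.\<close>

lemma all_matchings_card_le:
  assumes G: "weighted_graph V E w" and M: "M \<in> all_matchings E"
  shows "2 * card M \<le> card V"
proof -
  have fin: "finite V" and e: "\<And>e. e \<in> M \<Longrightarrow> e \<subseteq> V \<and> card e = 2"
    using G M by (auto simp: weighted_graph_def all_matchings_def)
  have "card (\<Union>M) = sum card M"
    using M e fin by (intro card_Union_disjoint) (auto simp: all_matchings_def intro: finite_subset)
  also have "\<dots> = 2 * card M"
    using e by simp
  finally show ?thesis
    using card_mono[OF fin, of "\<Union>M"] e by auto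
qed

lemma matching_poly_altdef:
  assumes "weighted_graph V E w"
  shows "matching_poly V E w =
    (\<Sum>M\<in>all_matchings E. monom ((-1) ^ card M * (\<Prod>e\<in>M. w e)) (card V - 2 * card M))"
proof -
  let ?f = "\<lambda>M. monom ((-1) ^ card M * (\<Prod>e\<in>M. w e)) (card V - 2 * card M)"
  have "matching_poly V E w = (\<Sum>k = 0..card V div 2. \<Sum>M\<in>{M \<in> all_matchings E. card M = k}. ?f M)"
    unfolding matching_poly_def
  proof (rule sum.cong)
    fix k
    have "matchings E k = {M \<in> all_matchings E. card M = k}"
      by (auto simp: matchings_def all_matchings_def)
    then show "monom ((-1) ^ k * matching_weight E w k) (card V - 2 * k) =
        (\<Sum>M\<in>{M \<in> all_matchings E. card M = k}. ?f M)"
      by (simp add: matching_weight_def sum_distrib_left flip: monom_sum)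
  qed simp
  also have "\<dots> = (\<Sum>M\<in>all_matchings E. ?f M)"
  proof (rule sum.group)
    show "finite (all_matchings E)"
      using assms by (intro finite_all_matchings weighted_graph_finite_edges)
    show "card ` all_matchings E \<subseteq> {0..card V div 2}"
      using all_matchings_card_le[OF assms] by fastforce
  qed simp
  finally show ?thesis .
qed

lemma matching_poly_cong:
  assumes "\<And>e. e \<in> E \<Longrightarrow> w e = w' e"
  shows "matching_poly V E w = matching_poly V E w'"
proof -
  have "matching_weight E w k = matching_weight E w' k" for k
    unfolding matching_weight_def matchings_def
    using assms by (intro sum.cong prod.cong) auto
  then show ?thesis
    by (simp add: matching_poly_def)
qed

lemma degree_matching_poly_le: "degree (matching_poly V E w) \<le> card V"
  unfolding matching_poly_def
  by (rule degree_sum_le) (auto intro: order_trans[OF degree_monom_le])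

lemma coeff_matching_poly_card:
  assumes "weighted_graph V E w"
  shows "coeff (matching_poly V E w) (card V) = 1"
proof -
  have "matchings E 0 = {{}}"
    using weighted_graph_finite_edges[OF assms]
    by (auto simp: matchings_def dest: finite_subset)
  then have "matching_weight E w 0 = 1"
    by (simp add: matching_weight_def)
  \<comment> \<open>A summand with \<open>k > 0\<close> has exponent strictly below
    \<open>card V\<close>, because its range then forces \<open>card V > 0\<close>.\<close>
  moreover have "coeff (matching_poly V E w) (card V) =
      (\<Sum>k\<in>{0}. (-1) ^ k * matching_weight E w k)"
    unfolding matching_poly_def coeff_sum coeff_monom
    by (rule sum.mono_neutral_cong_right) auto
  ultimately show ?thesis
    by simp
qed

lemma degree_matching_poly:
  assumes "weighted_graph V E w"
  shows "degree (matching_poly V E w) = card V"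
  using degree_matching_poly_le[of V E w] coeff_matching_poly_card[OF assms] le_degree[of "matching_poly V E w" "card V"]
  by simp

lemma lead_coeff_matching_poly:
  "weighted_graph V E w \<Longrightarrow> lead_coeff (matching_poly V E w) = 1"
  by (simp add: degree_matching_poly coeff_matching_poly_card)

section \<open>Deletion recursion at a vertex and nonnegativity of the Wronskian\<close>

lemma all_matchings_split:
  assumes G: "weighted_graph V E w"
  shows "all_matchings E = all_matchings (edges_without E v) \<union>
    (\<Union>k\<in>{k. {v, k} \<in> E}. insert {v, k} ` all_matchings (edges_without (edges_without E v) k))"
    (is "_ = ?A \<union> (\<Union>k\<in>?N. ?B k)")
proof (intro set_eqI iffI)
  fix M assume M: "M \<in> all_matchings E"
  show "M \<in> ?A \<union> (\<Union>k\<in>?N. ?B k)"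
  proof (cases "\<exists>e\<in>M. v \<in> e")
    case False
    then show ?thesis
      using M by (auto simp: all_matchings_def edges_without_def)
  next
    case True
    then obtain e where e: "e \<in> M" "v \<in> e"
      by blast
    then have "card e = 2" "e \<in> E"
      using G M by (auto simp: weighted_graph_def all_matchings_def)
    then obtain k where k: "e = {v, k}"
      using e(2) by (auto simp: card_2_iff doubleton_eq_iff)
    \<comment> \<open>By disjointness \<open>e\<close> is the only edge of \<open>M\<close> at
      \<open>v\<close>, and the remaining edges avoid both of its ends.\<close>
    have "disjnt f e" if "f \<in> M - {e}" for f
      using that M e(1) by (auto simp: all_matchings_def pairwise_def)
    then have "M - {e} \<in> all_matchings (edges_without (edges_without E v) k)"
      using M k by (auto simp: all_matchings_def edges_without_def disjnt_def intro: pairwise_subset)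
    moreover have "M = insert {v, k} (M - {e})"
      using e k by auto
    ultimately show ?thesis
      using k \<open>e \<in> E\<close> by blast
  qed
next
  fix M assume "M \<in> ?A \<union> (\<Union>k\<in>?N. ?B k)"
  then show "M \<in> all_matchings E"
    by (auto simp: all_matchings_def edges_without_def pairwise_insert disjnt_def)
qed

lemma matching_poly_recursion:
  assumes G: "weighted_graph V E w" and v: "v \<in> V"
  shows "matching_poly V E w =
    monom 1 1 * matching_poly (V - {v}) (edges_without E v) w -
    (\<Sum>k | {v, k} \<in> E. smult (w {v, k})
       (matching_poly (V - {v} - {k}) (edges_without (edges_without E v) k) w))"
proof -
  let ?E1 = "edges_without E v"
  let ?E2 = "\<lambda>k. edges_without (edges_without E v) k"
  let ?N = "{k. {v, k} \<in> E}"
  let ?B = "\<lambda>k. insert {v, k} ` all_matchings (?E2 k)"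
  let ?f = "\<lambda>V M. monom ((-1) ^ card M * (\<Prod>e\<in>M. w e)) (card V - 2 * card M)"
  note G1 = weighted_graph_edges_without[OF G, of v]
  note G2 = weighted_graph_edges_without[OF G1]
  have finV: "finite V"
    using G by (simp add: weighted_graph_def)
  have N: "?N \<subseteq> V - {v}"
    using G by (auto simp: weighted_graph_def dest: bspec)
  then have finN: "finite ?N"
    using finV by (meson finite_Diff finite_subset)
  have fin1: "finite (all_matchings ?E1)"
    by (intro finite_all_matchings weighted_graph_finite_edges[OF G1])
  have fin2: "finite (all_matchings (?E2 k))" for k
    by (intro finite_all_matchings weighted_graph_finite_edges[OF G2])
  have A: "?f V M = monom 1 1 * ?f (V - {v}) M" if M: "M \<in> all_matchings ?E1" for M
  proof -
    \<comment> \<open>The bound \<open>2 * card M \<le> card V - 1\<close> is what allows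
      \<open>Suc\<close> to be pulled out of the truncated subtraction.\<close>
    have "card V - 2 * card M = Suc (card (V - {v}) - 2 * card M)"
      using all_matchings_card_le[OF G1 M] card.remove[OF finV v] by linarith
    then show ?thesis
      by (simp add: mult_monom)
  qed
  \<comment> \<open>Two vertices fewer and one edge fewer leave the exponent unchanged; the extra
    edge contributes the sign and its weight.\<close>
  have B: "?f V (insert {v, k} M) = - smult (w {v, k}) (?f (V - {v} - {k}) M)"
    if k: "k \<in> ?N" and M: "M \<in> all_matchings (?E2 k)" for k M
  proof -
    have "finite M" "{v, k} \<notin> M"
      using M weighted_graph_finite_edges[OF G2, of k]
      by (auto simp: all_matchings_def edges_without_def dest: finite_subset)
    moreover have "card V = card (V - {v} - {k}) + 2"
      using card_Suc_Diff1[OF finV v] card_Suc_Diff1[of "V - {v}" k] finV subsetD[OF N k]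
      by (simp del: card_Diff_insert)
    ultimately show ?thesis
      by (simp add: smult_monom minus_monom algebra_simps)
  qed
  have "matching_poly V E w = (\<Sum>M\<in>all_matchings ?E1 \<union> (\<Union>k\<in>?N. ?B k). ?f V M)"
    unfolding matching_poly_altdef[OF G] all_matchings_split[OF G, of v, symmetric] ..
  also have "\<dots> = (\<Sum>M\<in>all_matchings ?E1. ?f V M) + (\<Sum>M\<in>(\<Union>k\<in>?N. ?B k). ?f V M)"
    by (rule sum.union_disjoint) (use fin1 fin2 finN in \<open>auto simp: all_matchings_def edges_without_def\<close>)
  also have "(\<Sum>M\<in>all_matchings ?E1. ?f V M) = monom 1 1 * matching_poly (V - {v}) ?E1 w"
    unfolding matching_poly_altdef[OF G1] sum_distrib_left by (rule sum.cong) (use A in auto)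
  also have "(\<Sum>M\<in>(\<Union>k\<in>?N. ?B k). ?f V M) = (\<Sum>k\<in>?N. \<Sum>M\<in>?B k. ?f V M)"
  proof (rule sum.UNION_disjoint)
    show "\<forall>k\<in>?N. \<forall>l\<in>?N. k \<noteq> l \<longrightarrow> ?B k \<inter> ?B l = {}"
    proof (intro ballI impI)
      fix k l :: 'a assume kl: "k \<noteq> l"
      \<comment> \<open>The only edge at \<open>v\<close> in a member of \<open>?B l\<close> is
        \<open>{v, l}\<close>.\<close>
      have "{v, k} \<notin> M" if "M \<in> ?B l" for M
        using that kl by (auto simp: all_matchings_def edges_without_def doubleton_eq_iff)
      then show "?B k \<inter> ?B l = {}"
        by blast
    qed
  qed (use finN fin2 in auto)
  also have "\<dots> = (\<Sum>k\<in>?N. - smult (w {v, k}) (matching_poly (V - {v} - {k}) (?E2 k) w))"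
  proof (rule sum.cong)
    fix k assume k: "k \<in> ?N"
    have "{v, k} \<notin> M" if "M \<in> all_matchings (?E2 k)" for M
      using that by (auto simp: all_matchings_def edges_without_def)
    then have "inj_on (insert {v, k}) (all_matchings (?E2 k))"
      by (intro inj_onI) (metis insert_ident)
    then have "(\<Sum>M\<in>?B k. ?f V M) = (\<Sum>M\<in>all_matchings (?E2 k). ?f V (insert {v, k} M))"
      by (simp only: sum.reindex comp_def)
    also have "\<dots> = (\<Sum>M\<in>all_matchings (?E2 k). - smult (w {v, k}) (?f (V - {v} - {k}) M))"
      by (rule sum.cong) (use B[OF k] in auto)
    finally show "(\<Sum>M\<in>?B k. ?f V M) = - smult (w {v, k}) (matching_poly (V - {v} - {k}) (?E2 k) w)"
      unfolding matching_poly_altdef[OF G2] 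
      by (simp only: poly_eq_iff coeff_sum coeff_minus coeff_smult sum_distrib_left sum_negf) simp
  qed simp
  finally show ?thesis
    by (simp add: sum_negf)
qed

text \<open>The recursion at \<open>v\<close> turns this Wronskian into a square plus a positively
  weighted sum of Wronskians for the graph without \<open>v\<close> and its further deletions, to
  which induction on the number of vertices applies.\<close>

lemma matching_poly_wronskian_nonneg:
  assumes "weighted_graph V E w" "v \<in> V"
  shows "poly (matching_poly (V - {v}) (edges_without E v) w) x * poly (pderiv (matching_poly V E w)) x
    - poly (pderiv (matching_poly (V - {v}) (edges_without E v) w)) x * poly (matching_poly V E w) x \<ge> 0"
  using assms
proof (induction "card V" arbitrary: V E v rule: less_induct)
  case less
  let ?E1 = "edges_without E v"
  let ?N = "{k. {v, k} \<in> E}"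
  define A where "A = matching_poly (V - {v}) ?E1 w"
  define B where "B k = matching_poly (V - {v} - {k}) (edges_without ?E1 k) w" for k
  note G = less.prems(1)
  have N: "k \<in> V - {v}" if "k \<in> ?N" for k
    using G that by (auto simp: weighted_graph_def dest: bspec)
  have rec: "matching_poly V E w = monom 1 1 * A - (\<Sum>k\<in>?N. smult (w {v, k}) (B k))"
    unfolding A_def B_def by (rule matching_poly_recursion[OF less.prems])
  have val: "poly (matching_poly V E w) x = x * poly A x - (\<Sum>k\<in>?N. w {v, k} * poly (B k) x)"
    unfolding rec by (simp add: poly_monom poly_sum)
  have der: "poly (pderiv (matching_poly V E w)) x =
      poly A x + x * poly (pderiv A) x - (\<Sum>k\<in>?N. w {v, k} * poly (pderiv (B k)) x)"
    unfolding rec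
    by (simp add: poly_monom poly_sum pderiv_diff pderiv_mult pderiv_smult pderiv_monom
        higher_pderiv_sum[of 1, simplified])
  have IH: "w {v, k} * (poly (B k) x * poly (pderiv A) x - poly (pderiv (B k)) x * poly A x) \<ge> 0"
    if "k \<in> ?N" for k
  proof (rule mult_nonneg_nonneg)
    show "w {v, k} \<ge> 0"
      using G that by (auto simp: weighted_graph_def less_imp_le)
    have "card (V - {v}) < card V"
      using G less.prems(2) card_Diff1_less[of V v] unfolding weighted_graph_def by blast
    then show "poly (B k) x * poly (pderiv A) x - poly (pderiv (B k)) x * poly A x \<ge> 0"
      unfolding A_def B_def
      using weighted_graph_edges_without[OF G] N[OF that] by (rule less.hyps)
  qed
  \<comment> \<open>The term \<open>x * A\<close> contributes
    \<open>A * (A + x * A') - A' * x * A\<close>, which is the square of \<open>A\<close>.\<close>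
  have "poly A x * poly (pderiv (matching_poly V E w)) x - poly (pderiv A) x * poly (matching_poly V E w) x
     = (poly A x)\<^sup>2 +
       (\<Sum>k\<in>?N. w {v, k} * (poly (B k) x * poly (pderiv A) x - poly (pderiv (B k)) x * poly A x))"
    unfolding val der
    by (simp add: algebra_simps power2_eq_square sum_subtractf sum_distrib_left)
  also have "\<dots> \<ge> 0"
    using IH by (intro add_nonneg_nonneg sum_nonneg) auto
  finally show ?case
    unfolding A_def .
qed

section \<open>Strict interlacing after a graph expansion\<close>

theorem theorem3p9:
  fixes V' V :: "'a set" and E' E :: "'a set set" and w' w :: "'a set \<Rightarrow> real" and u v :: 'a
  assumes "weighted_graph V' E' w'"
    and "u \<in> V'"
    and "SRSI V' E' w' u"
    and "graph_expansion V' E' w' u v V E w"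
  shows "SRSI V E w v"
proof -
  have G: "weighted_graph V E w" and v: "v \<notin> V'" and V: "V = V' \<union> {v}"
    and ww: "\<And>e. e \<in> E' \<Longrightarrow> w e = w' e"
    using assms(4) by (auto simp: graph_expansion_def)
  obtain N where N: "u \<in> N" "N \<subseteq> V'" "E = E' \<union> (\<lambda>x. {v, x}) ` N"
    using assms(4) by (auto simp: graph_expansion_def)
  have fin: "finite V'" and E'sub: "\<And>e. e \<in> E' \<Longrightarrow> e \<subseteq> V'"
    using assms(1) by (auto simp: weighted_graph_def)
  have E': "edges_without E v = E'" and V': "V - {v} = V'"
    using N v V E'sub by (auto simp: edges_without_def)
  have G': "weighted_graph V' E' w"
    using weighted_graph_edges_without[OF G, of v] by (simp add: E' V')
  have nbr: "{k. {v, k} \<in> E} = N"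
    using N v E'sub by (auto simp: doubleton_eq_iff)
  define P where "P = matching_poly V E w"
  define Q where "Q = matching_poly V' E' w"
  define R where "R k = matching_poly (V' - {k}) (edges_without E' k) w" for k
  \<comment> \<open>The recursion for \<open>G\<close> produces polynomials weighted by
    \<open>w\<close>, while the hypothesis on \<open>G'\<close> speaks of \<open>w'\<close>;
    agreement on \<open>E'\<close> identifies them.\<close>
  have Q': "Q = matching_poly V' E' w'"
    unfolding Q_def using ww by (rule matching_poly_cong)
  have Ru: "R u = matching_poly (V' - {u}) (edges_without E' u) w'"
    unfolding R_def by (rule matching_poly_cong) (use ww in \<open>auto simp: edges_without_def\<close>)
  define n where "n = card V'"
  obtain r mu where n2: "n \<ge> 2" and r: "has_simple_roots Q n r"
    and mu: "has_simple_roots (R u) (n - 1) mu"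
    and inter: "\<And>i. i \<in> {1..n - 1} \<Longrightarrow> r i < mu i \<and> mu i < r (i + 1)"
    using assms(3) unfolding SRSI_def Q'[symmetric] Ru[symmetric] n_def[symmetric] by auto
  have cV: "card V = n + 1"
    using V v fin by (simp add: n_def)
  have Qm: "degree Q = n" "lead_coeff Q = 1"
    unfolding Q_def n_def using G' by (rule degree_matching_poly lead_coeff_matching_poly)+
  have Pm: "degree P = n + 1" "lead_coeff P = 1"
    unfolding P_def cV[symmetric] using G by (rule degree_matching_poly lead_coeff_matching_poly)+
  have rec: "P = monom 1 1 * Q - (\<Sum>k\<in>N. smult (w {v, k}) (R k))"
    using matching_poly_recursion[OF G, of v] V unfolding nbr E' V' P_def Q_def R_def by simp
  have mono: "strict_mono_on {1..n} r"
    using r by (simp add: has_simple_roots_def)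
  have sign: "poly P (r i) * poly (pderiv Q) (r i) < 0" if i: "i \<in> {1..n}" for i
  proof -
    have root: "poly Q (r i) = 0"
      using r i by (auto simp: has_simple_roots_def)
    have w_pos: "w {v, k} > 0" if "k \<in> N" for k
      using G N that by (auto simp: weighted_graph_def)
    \<comment> \<open>At a root of \<open>Q\<close> the second term of the Wronskian
      vanishes.\<close>
    have nonneg: "poly (R k) (r i) * poly (pderiv Q) (r i) \<ge> 0" if "k \<in> N" for k
      using matching_poly_wronskian_nonneg[OF G', of k "r i"] that N root
      by (auto simp: Q_def R_def)
    \<comment> \<open>Otherwise strict interlacing would put \<open>r i\<close> strictly between
      \<open>r j\<close> and \<open>r (j + 1)\<close>, hence \<open>i\<close> strictly between
      consecutive integers.\<close>
    have "poly (R u) (r i) \<noteq> 0"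
    proof
      assume "poly (R u) (r i) = 0"
      then obtain j where j: "j \<in> {1..n - 1}" "r i = mu j"
        using mu unfolding has_simple_roots_def by blast
      then have "r j < r i" "r i < r (j + 1)"
        using inter[of j] by auto
      moreover have "j \<in> {1..n}" "j + 1 \<in> {1..n}"
        using j by auto
      ultimately have "j < i" "i < j + 1"
        using i mono by (metis strict_mono_on_less)+
      then show False
        by simp
    qed
    moreover have "poly (pderiv Q) (r i) \<noteq> 0"
      using has_simple_roots_pderiv_sign[OF r Qm i] by auto
    ultimately have pos: "poly (R u) (r i) * poly (pderiv Q) (r i) > 0"
      using nonneg[OF N(1)] by (metis less_le mult_eq_0_iff)
    \<comment> \<open>Terms for other neighbours may vanish, so strict positivity comes from
      \<open>u\<close> alone.\<close>
    have "(\<Sum>k\<in>N. w {v, k} * (poly (R k) (r i) * poly (pderiv Q) (r i))) > 0"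
    proof (rule sum_pos2[of _ u])
      show "finite N"
        using N fin by (metis finite_subset)
      show "u \<in> N"
        by (rule N)
      show "w {v, u} * (poly (R u) (r i) * poly (pderiv Q) (r i)) > 0"
        using pos w_pos[OF N(1)] by simp
      show "w {v, k} * (poly (R k) (r i) * poly (pderiv Q) (r i)) \<ge> 0" if "k \<in> N" for k
        using nonneg[OF that] w_pos[OF that] by simp
    qed
    moreover have "poly P (r i) = - (\<Sum>k\<in>N. w {v, k} * poly (R k) (r i))"
      unfolding rec using root by (simp add: poly_sum)
    ultimately show ?thesis
      by (simp add: sum_distrib_right mult.assoc)
  qed
  obtain lam where lam: "has_simple_roots P (n + 1) lam"
    "\<forall>i\<in>{1..n}. lam i < r i \<and> r i < lam (i + 1)"
    using ex_interlacing_roots[OF Pm Qm r _ sign] n2 by auto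
  show ?thesis
    \<comment> \<open>Deleting \<open>v\<close> gives back \<open>G'\<close>, so the interlacing
      sequence required for \<open>G\<close> is \<open>r\<close>, the roots of
      \<open>Q\<close>.\<close>
    unfolding SRSI_def E' V' cV
    using G V n2 lam r by (auto simp: P_def Q_def)
qed

end
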